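(* Let $p,q,n$ be positive integers with $q\ge p\ge 2$ and $n\ge p+q+2$. If $p\ge 3$ or $q\ge 4$, then $ex_{\mathcal{OP}}(n,S_{p,q})=2n-3$.
   Context: All graphs are finite, simple and undirected. For integers $q\ge p\ge 1$, the double star $S_{p,q}$ is the graph obtained from an edge $xy$ by joining $x$ to $p$ new vertices and $y$ to $q$ further new vertices. A graph is $H$-free if it contains no subgraph isomorphic to $H$. A graph is outerplanar if it has a planar embedding with all vertices on the boundary of the outer face. $ex_{\mathcal{OP}}(n,H)$ denotes the maximum number of edges of an $H$-free outerplanar graph on $n$ vertices. *)

theory Defs
  imports "HOL-Analysis.Analysis"
begin

type_synonym 'a graph = "'a set \<times> 'a set set"

abbreviation verts :: "'a graph \<Rightarrow> 'a set" where "verts \<equiv> fst"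
abbreviation edges :: "'a graph \<Rightarrow> 'a set set" where "edges \<equiv> snd"

definition simple_graph :: "'a graph \<Rightarrow> bool" where
  "simple_graph G \<longleftrightarrow> finite (verts G) \<and> (\<forall>e\<in>edges G. e \<subseteq> verts G \<and> card e = 2)"

definition is_subgraph :: "'a graph \<Rightarrow> 'a graph \<Rightarrow> bool" where
  "is_subgraph K G \<longleftrightarrow> simple_graph K \<and> verts K \<subseteq> verts G \<and> edges K \<subseteq> edges G"

definition graph_iso :: "'a graph \<Rightarrow> 'b graph \<Rightarrow> bool" where
  "graph_iso G K \<longleftrightarrow> (\<exists>f. bij_betw f (verts G) (verts K) \<and> (\<lambda>e. f ` e) ` edges G = edges K)"

definition free_of :: "'b graph \<Rightarrow> 'a graph \<Rightarrow> bool" where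
  "free_of H G \<longleftrightarrow> \<not> (\<exists>K. is_subgraph K G \<and> graph_iso H K)"

datatype dstar_vertex = CentreX | CentreY | LeafX nat | LeafY nat

definition double_star :: "nat \<Rightarrow> nat \<Rightarrow> dstar_vertex graph" where
  "double_star p q =
     ({CentreX, CentreY} \<union> LeafX ` {..<p} \<union> LeafY ` {..<q},
      {{CentreX, CentreY}} \<union> (\<lambda>i. {CentreX, LeafX i}) ` {..<p} \<union> (\<lambda>j. {CentreY, LeafY j}) ` {..<q})"

text \<open>A planar embedding places the vertices at distinct points \<open>z v\<close> of the plane and draws each
  edge \<open>e\<close> as a simple arc \<open>c e\<close> joining its ends (in either direction), such that an arc passes
  through no other vertex and two arcs meet at most in the images of common ends.\<close>

definition planar_embedding ::
  "'a graph \<Rightarrow> ('a \<Rightarrow> complex) \<Rightarrow> ('a set \<Rightarrow> real \<Rightarrow> complex) \<Rightarrow> bool" where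
  "planar_embedding G z c \<longleftrightarrow>
     inj_on z (verts G) \<and>
     (\<forall>e\<in>edges G. arc (c e) \<and> {pathstart (c e), pathfinish (c e)} = z ` e \<and>
        path_image (c e) \<inter> z ` verts G = z ` e) \<and>
     (\<forall>e\<in>edges G. \<forall>e'\<in>edges G. e \<noteq> e' \<longrightarrow>
        path_image (c e) \<inter> path_image (c e') \<subseteq> z ` (e \<inter> e'))"

definition drawing ::
  "'a graph \<Rightarrow> ('a \<Rightarrow> complex) \<Rightarrow> ('a set \<Rightarrow> real \<Rightarrow> complex) \<Rightarrow> complex set" where
  "drawing G z c = z ` verts G \<union> (\<Union>e\<in>edges G. path_image (c e))"

text \<open>The drawing of a finite graph is bounded, so \<^const>\<open>outside\<close>, the union of the unbounded
  components of its complement, is a single component: the outer face.\<close>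

definition outerplanar :: "'a graph \<Rightarrow> bool" where
  "outerplanar G \<longleftrightarrow>
     (\<exists>z c. planar_embedding G z c \<and> z ` verts G \<subseteq> frontier (outside (drawing G z c)))"

text \<open>Every finite graph is isomorphic to one whose vertices are natural numbers, so it suffices to
  range over those.\<close>

definition op_edge_counts :: "nat \<Rightarrow> 'b graph \<Rightarrow> nat set" where
  "op_edge_counts n H =
     {card (edges G) | G :: nat graph.
        simple_graph G \<and> card (verts G) = n \<and> outerplanar G \<and> free_of H G}"

definition ex_OP :: "nat \<Rightarrow> 'b graph \<Rightarrow> nat" where
  "ex_OP n H = Max (op_edge_counts n H)"

lemma finite_op_edge_counts: "finite (op_edge_counts n H)"
proof -
  have "card (edges G) \<le> 2 ^ n" if "simple_graph G" "card (verts G) = n" for G :: "nat graph"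
  proof -
    have "edges G \<subseteq> Pow (verts G)" "finite (verts G)"
      using that by (auto simp: simple_graph_def)
    then show ?thesis
      using that card_mono[of "Pow (verts G)" "edges G"] by (simp add: card_Pow)
  qed
  then have "op_edge_counts n H \<subseteq> {..2 ^ n}"
    by (auto simp: op_edge_counts_def)
  then show ?thesis
    by (rule finite_subset) simp
qed

end

theory Submission
  imports Defs "HOL-Complex_Analysis.Complex_Analysis"
begin

text \<open>Upper bound: a graph with more than \<open>2n - 3\<close> edges has a subgraph of minimum degree at least \<open>3\<close>,
  and this contains a subdivision of \<open>K\<^sub>4\<close>. In an outerplanar drawing of such a subdivision no branch
  vertex lies inside a closed curve of the drawing. Comparing winding numbers, in a theta graph one of
  the three arcs runs inside the closed curve of the other two; applied to the three paths from \<open>c\<close>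
  to \<open>d\<close>, directly, through \<open>a\<close> and through \<open>b\<close>, it places the path \<open>cd\<close> inside the closed curve
  \<open>acbd\<close>. The path \<open>ab\<close> cuts this curve into two closed curves, both with \<open>cd\<close> on the outside, a
  contradiction.

  Lower bound: the square of a path has \<open>2n - 3\<close> edges and maximum degree \<open>4\<close>, and the two ends of
  an edge have at most \<open>5\<close> further neighbours in total, which excludes \<open>S\<^bsub>p,q\<^esub>\<close>.
  It is drawn as a triangulated strip.\<close>

subsection \<open>Theta graphs and \<open>K\<^sub>4\<close> in the plane\<close>

lemma simple_path_two_arcs:
  assumes "arc p" "arc q" "pathstart p = a" "pathfinish p = b" "pathstart q = a" "pathfinish q = b"
    and "path_image p \<inter> path_image q \<subseteq> {a, b}"
  shows "simple_path (p +++ reversepath q)"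
    and "pathfinish (p +++ reversepath q) = pathstart (p +++ reversepath q)"
    and "path_image (p +++ reversepath q) = path_image p \<union> path_image q"
proof -
  show "simple_path (p +++ reversepath q)"
    using assms by (intro simple_path_join_loop) (auto simp: arc_reversepath)
qed (use assms in \<open>auto simp: path_image_join\<close>)

text \<open>The simple closed curve formed by \<open>p\<close> and the reverse of \<open>q\<close>
  has winding number 1 or -1 about points inside it and 0 about points outside it, and this number
  is the difference of the winding numbers of the two arcs.\<close>

lemma inside_two_arcs_iff_winding_number:
  fixes p q :: "real \<Rightarrow> complex"
  assumes "arc p" "arc q" "pathstart p = a" "pathfinish p = b" "pathstart q = a" "pathfinish q = b"
    and "path_image p \<inter> path_image q \<subseteq> {a, b}"
    and z: "z \<notin> path_image p" "z \<notin> path_image q"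
  shows "z \<in> inside (path_image p \<union> path_image q) \<longleftrightarrow> winding_number p z \<noteq> winding_number q z"
proof -
  define g where "g = p +++ reversepath q"
  note g = simple_path_two_arcs[OF assms(1-7), folded g_def]
  have w: "winding_number g z = winding_number p z - winding_number q z"
    using assms by (simp add: g_def winding_number_join winding_number_reversepath arc_imp_path)
  have "z \<in> inside (path_image g) \<longleftrightarrow> winding_number g z \<noteq> 0"
  proof
    assume "z \<in> inside (path_image g)"
    then show "winding_number g z \<noteq> 0"
      using simple_closed_path_norm_winding_number_inside[OF g(1)] by fastforce
  next
    assume "winding_number g z \<noteq> 0"
    then have "z \<notin> outside (path_image g)"
      using winding_number_zero_in_outside g(1,2) simple_path_imp_path by blast
    then show "z \<in> inside (path_image g)"
      using z g(3) inside_Un_outside[of "path_image g"] by blast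
  qed
  then show ?thesis
    using w g(3) by auto
qed

lemma connected_disjoint_subset_inside:
  assumes "connected T" "T \<inter> S = {}" "x \<in> T" "x \<in> inside S"
  shows "T \<subseteq> inside S"
  using assms inside_outside_intersect_connected[OF assms(1), of S] inside_Un_outside[of S] by blast

text \<open>The inside of the curve of \<open>p\<close> and \<open>q\<close> is connected and misses
  both \<open>p\<close> and \<open>r\<close>, so the common point \<open>z\<close> places all of it
  inside the curve of \<open>p\<close> and \<open>r\<close>. The point \<open>s\<close> of
  \<open>q\<close> is a limit of that region; as it lies on neither \<open>p\<close> nor
  \<open>r\<close>, it is inside as well.\<close>

lemma inside_two_arcs_overlap:
  fixes p q r :: "real \<Rightarrow> complex"
  assumes arcs: "arc p" "arc q" "arc r"
    and ends: "pathstart p = a" "pathfinish p = b" "pathstart q = a" "pathfinish q = b"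
      "pathstart r = a" "pathfinish r = b"
    and int: "path_image p \<inter> path_image q \<subseteq> {a, b}" "path_image q \<inter> path_image r \<subseteq> {a, b}"
    and disj: "path_image r \<inter> inside (path_image p \<union> path_image q) = {}"
    and z: "z \<in> inside (path_image p \<union> path_image q)" "z \<in> inside (path_image p \<union> path_image r)"
    and s: "s \<in> path_image q" "s \<noteq> a" "s \<noteq> b" "s \<notin> path_image p"
  shows "s \<in> inside (path_image p \<union> path_image r)"
proof -
  define I where "I = inside (path_image p \<union> path_image q)"
  note g = simple_path_two_arcs[OF arcs(1,2) ends(1-4) int(1)]
  have I: "connected I" "frontier I = path_image p \<union> path_image q"
    using Jordan_inside_outside[OF g(1,2)] unfolding g(3) I_def by auto
  have "I \<inter> (path_image p \<union> path_image r) = {}"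
    using disj inside_no_overlap[of "path_image p \<union> path_image q"] unfolding I_def by blast
  then have "I \<subseteq> inside (path_image p \<union> path_image r)"
    using connected_disjoint_subset_inside[OF I(1)] z unfolding I_def by blast
  then have "closure I \<subseteq> closure (inside (path_image p \<union> path_image r))"
    by (rule closure_mono)
  also have "\<dots> \<subseteq> path_image p \<union> path_image r \<union> inside (path_image p \<union> path_image r)"
    by (intro closure_inside_subset closed_Un closed_arc_image arcs)
  finally have "closure I \<subseteq> \<dots>" .
  moreover have "s \<in> closure I"
    using I(2) s(1) by (auto simp: frontier_def)
  moreover have "s \<notin> path_image r"
    using int(2) s by auto
  ultimately show ?thesis
    using s by auto
qed

text \<open>Suppose \<open>r\<close> avoids the inside of the curve of \<open>p\<close> and
  \<open>q\<close>, and take \<open>z\<close> there. The winding numbers of \<open>p\<close> and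
  \<open>q\<close> about \<open>z\<close> differ, so that of \<open>r\<close> differs from one of
  them, and \<open>z\<close> is also inside the curve formed by \<open>r\<close> and that arc. By
  the overlap lemma the witness \<open>s\<close> or \<open>t\<close> on the remaining arc is then
  inside this curve, against the assumption.\<close>

lemma theta_middle_arc:
  fixes p q r :: "real \<Rightarrow> complex"
  assumes arcs: "arc p" "arc q" "arc r"
    and ends: "pathstart p = a" "pathfinish p = b" "pathstart q = a" "pathfinish q = b"
      "pathstart r = a" "pathfinish r = b"
    and int: "path_image p \<inter> path_image q \<subseteq> {a, b}" "path_image q \<inter> path_image r \<subseteq> {a, b}"
      "path_image p \<inter> path_image r \<subseteq> {a, b}"
    and s: "s \<in> path_image p - {a, b}" "s \<notin> inside (path_image q \<union> path_image r)"
    and t: "t \<in> path_image q - {a, b}" "t \<notin> inside (path_image p \<union> path_image r)"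
    and x: "x \<in> path_image r - {a, b}"
  shows "x \<in> inside (path_image p \<union> path_image q)"
proof (rule ccontr)
  assume nx: "x \<notin> inside (path_image p \<union> path_image q)"
  define I where "I = inside (path_image p \<union> path_image q)"
  have ab: "a \<in> path_image p" "b \<in> path_image p"
    using ends by auto
  have nI: "I \<inter> (path_image p \<union> path_image q) = {}"
    unfolding I_def by (rule inside_no_overlap)
  \<comment> \<open>Without its ends, \<open>r\<close> is connected and misses the curve of
    \<open>p\<close> and \<open>q\<close>, so the single point \<open>x\<close> decides on which
    side all of it runs.\<close>
  have "connected (path_image r - {a, b})"
    using connected_simple_path_endless[OF arc_imp_simple_path[OF arcs(3)]] ends by simp
  moreover have "(path_image r - {a, b}) \<inter> (path_image p \<union> path_image q) = {}"
    using int(2,3) by blast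
  ultimately have "(path_image r - {a, b}) \<inter> I = {}"
    using connected_disjoint_subset_inside[of "path_image r - {a, b}" "path_image p \<union> path_image q"]
      nx x unfolding I_def by blast
  then have disj: "path_image r \<inter> I = {}"
    using ab nI by blast
  note g = simple_path_two_arcs[OF arcs(1,2) ends(1-4) int(1)]
  obtain z where z: "z \<in> I"
    using Jordan_inside_outside[OF g(1,2)] unfolding g(3) I_def by auto
  then have zn: "z \<notin> path_image p" "z \<notin> path_image q" "z \<notin> path_image r"
    using nI disj by blast+
  have sym: "path_image q \<inter> path_image p \<subseteq> {a, b}" "path_image q \<union> path_image p = path_image p \<union> path_image q"
    using int(1) by blast+
  have "winding_number p z \<noteq> winding_number q z"
    using z inside_two_arcs_iff_winding_number[OF arcs(1,2) ends(1-4) int(1) zn(1,2)]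
    unfolding I_def by simp
  then consider "winding_number p z \<noteq> winding_number r z" | "winding_number q z \<noteq> winding_number r z"
    by metis
  then show False
  proof cases
    case 1
    then have "z \<in> inside (path_image p \<union> path_image r)"
      using inside_two_arcs_iff_winding_number[OF arcs(1,3) ends(1,2,5,6) int(3) zn(1,3)] by simp
    then have "t \<in> inside (path_image p \<union> path_image r)"
      using inside_two_arcs_overlap[OF arcs ends int(1,2), of z t] disj z t(1) int(1) unfolding I_def by blast
    then show False using t by simp
  next
    case 2
    then have "z \<in> inside (path_image q \<union> path_image r)"
      using inside_two_arcs_iff_winding_number[OF arcs(2,3) ends(3-6) int(2) zn(2,3)] by simp
    then have "s \<in> inside (path_image q \<union> path_image r)"
      using inside_two_arcs_overlap[OF arcs(2,1,3) ends(3,4,1,2,5,6) sym(1) int(3), of z s]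
        disj z s(1) sym(1) unfolding I_def sym(2) by blast
    then show False using s by simp
  qed
qed

text \<open>This is how the outer face enters: a larger set has a smaller outside, so
  \<open>x\<close> is a limit of points outside \<open>S\<close>, and for closed \<open>S\<close>
  such limits lie in \<open>S\<close> or outside it.\<close>

lemma not_in_inside_if_outer:
  fixes S :: "'a::real_normed_vector set"
  assumes "x \<in> frontier (outside D)" "S \<subseteq> D" "closed S"
  shows "x \<notin> inside S"
proof
  assume "x \<in> inside S"
  moreover have "x \<in> closure (outside S)"
    using assms closure_mono[OF outside_mono[OF assms(2)]] by (auto simp: frontier_def)
  ultimately show False
    using closure_outside_subset[OF assms(3)] inside_no_overlap[of S] inside_Int_outside[of S] by blast
qed

lemma arc_join_props:
  assumes "arc p" "arc q" "pathfinish p = pathstart q" "path_image p \<inter> path_image q \<subseteq> {pathstart q}"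
  shows "arc (p +++ q) \<and> pathstart (p +++ q) = pathstart p \<and> pathfinish (p +++ q) = pathfinish q
    \<and> path_image (p +++ q) = path_image p \<union> path_image q"
  using assms by (auto simp: arc_join path_image_join)

definition arc_between :: "'a::topological_space \<Rightarrow> 'a \<Rightarrow> (real \<Rightarrow> 'a) \<Rightarrow> bool" where
  "arc_between a b p \<longleftrightarrow> arc p \<and> pathstart p = a \<and> pathfinish p = b"

lemma no_outer_K4:
  fixes ab ac ad bc bd cd :: "real \<Rightarrow> complex"
  assumes arcs: "arc_between a b ab" "arc_between a c ac" "arc_between a d ad"
      "arc_between b c bc" "arc_between b d bd" "arc_between c d cd"
    and int: "path_image ab \<inter> path_image ac \<subseteq> {a}" "path_image ab \<inter> path_image ad \<subseteq> {a}"
      "path_image ac \<inter> path_image ad \<subseteq> {a}"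
      "path_image ab \<inter> path_image bc \<subseteq> {b}" "path_image ab \<inter> path_image bd \<subseteq> {b}"
      "path_image bc \<inter> path_image bd \<subseteq> {b}"
      "path_image ac \<inter> path_image bc \<subseteq> {c}" "path_image ac \<inter> path_image cd \<subseteq> {c}"
      "path_image bc \<inter> path_image cd \<subseteq> {c}"
      "path_image ad \<inter> path_image bd \<subseteq> {d}" "path_image ad \<inter> path_image cd \<subseteq> {d}"
      "path_image bd \<inter> path_image cd \<subseteq> {d}"
      "path_image ab \<inter> path_image cd = {}" "path_image ac \<inter> path_image bd = {}"
      "path_image ad \<inter> path_image bc = {}"
    and sub: "path_image ab \<union> path_image ac \<union> path_image ad \<union> path_image bc \<union> path_image bd
      \<union> path_image cd \<subseteq> D"
    and outer: "{a, b, c, d} \<subseteq> frontier (outside D)"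
  shows False
proof -
  have A: "arc ab" "arc ac" "arc ad" "arc bc" "arc bd" "arc cd"
    and E: "pathstart ab = a" "pathfinish ab = b" "pathstart ac = a" "pathfinish ac = c"
      "pathstart ad = a" "pathfinish ad = d" "pathstart bc = b" "pathfinish bc = c"
      "pathstart bd = b" "pathfinish bd = d" "pathstart cd = c" "pathfinish cd = d"
    using arcs by (auto simp: arc_between_def)
  have mem: "a \<in> path_image ab" "a \<in> path_image ac" "a \<in> path_image ad"
    "b \<in> path_image ab" "b \<in> path_image bc" "b \<in> path_image bd"
    "c \<in> path_image ac" "c \<in> path_image bc" "c \<in> path_image cd"
    "d \<in> path_image ad" "d \<in> path_image bd" "d \<in> path_image cd"
    using E pathstart_in_path_image pathfinish_in_path_image by metis+
  \<comment> \<open>Any two of the four points lie on different members of a pair of disjoint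
    opposite arcs.\<close>
  have ne: "a \<noteq> b" "a \<noteq> c" "a \<noteq> d" "b \<noteq> c" "b \<noteq> d" "c \<noteq> d"
    using mem int(13-15) by blast+
  \<comment> \<open>With \<open>cd\<close>, the arcs \<open>p\<close> through \<open>a\<close> and
    \<open>q\<close> through \<open>b\<close> form a theta graph with ends \<open>c\<close> and
    \<open>d\<close>; the outer vertices \<open>a\<close> and \<open>b\<close> are the witnesses
    that neither \<open>p\<close> nor \<open>q\<close> is the middle arc.\<close>
  define p where "p = reversepath ac +++ ad"
  define q where "q = reversepath bc +++ bd"
  have p: "arc p" "pathstart p = c" "pathfinish p = d" "path_image p = path_image ac \<union> path_image ad"
    using arc_join_props[of "reversepath ac" ad] A E int(3) by (auto simp: p_def arc_reversepath)
  have q: "arc q" "pathstart q = c" "pathfinish q = d" "path_image q = path_image bc \<union> path_image bd"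
    using arc_join_props[of "reversepath bc" bd] A E int(6) by (auto simp: q_def arc_reversepath)
  have inner: "x \<in> inside (path_image p \<union> path_image q)" if "x \<in> path_image cd - {c, d}" for x
  proof (rule theta_middle_arc[OF p(1) q(1) A(6) p(2,3) q(2,3) E(11,12)])
    show "a \<notin> inside (path_image q \<union> path_image cd)"
      by (rule not_in_inside_if_outer[of _ D]) (use outer sub q A in \<open>auto intro!: closed_Un closed_arc_image\<close>)
    show "b \<notin> inside (path_image p \<union> path_image cd)"
      by (rule not_in_inside_if_outer[of _ D]) (use outer sub p A in \<open>auto intro!: closed_Un closed_arc_image\<close>)
    show "path_image p \<inter> path_image q \<subseteq> {c, d}"
      unfolding p q using int(7,10,14,15) by blast
    show "path_image q \<inter> path_image cd \<subseteq> {c, d}"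
      unfolding q using int(9,12) by blast
    show "path_image p \<inter> path_image cd \<subseteq> {c, d}"
      unfolding p using int(8,11) by blast
    show "a \<in> path_image p - {c, d}" "b \<in> path_image q - {c, d}"
      using mem ne p q by auto
  qed (rule that)
  have "path_image cd - {c, d} \<noteq> {}"
    using nonempty_simple_path_endless[OF arc_imp_simple_path[OF A(6)]] E by simp
  then obtain x where x: "x \<in> path_image cd" "x \<noteq> c" "x \<noteq> d" by auto
  have xn: "x \<notin> path_image ab" "x \<notin> path_image ac" "x \<notin> path_image ad"
    "x \<notin> path_image bc" "x \<notin> path_image bd"
    using x int(8,9,11-13) by blast+
  have con: "connected (path_image cd - {c, d})"
    using connected_simple_path_endless[OF arc_imp_simple_path[OF A(6)]] E by simp
  \<comment> \<open>If \<open>x\<close> were inside \<open>S\<close>, so would be all of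
    \<open>cd\<close> without its ends, by connectedness. The end \<open>y\<close> is a limit of
    this set and not on \<open>S\<close>, so it would be inside too, although it is on the outer
    face.\<close>
  have half: "x \<notin> inside S"
    if S: "closed S" "S \<subseteq> D" "S \<inter> (path_image cd - {c, d}) = {}" "y \<in> {c, d}" "y \<notin> S" for S y
  proof
    assume "x \<in> inside S"
    then have "path_image cd - {c, d} \<subseteq> inside S"
      using connected_disjoint_subset_inside[OF con, of S x] x S by auto
    then have "closure (path_image cd - {c, d}) \<subseteq> S \<union> inside S"
      using closure_inside_subset[OF S(1)] closure_mono by blast
    moreover have "y \<in> closure (path_image cd - {c, d})"
    proof -
      \<comment> \<open>By continuity at the parameters 0 and 1, both ends are limits of the open
        arc.\<close>
      have "cd ` closure {0<..<1} \<subseteq> closure (cd ` {0<..<1})"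
        using arc_imp_path[OF A(6)] by (intro image_closure_subset) (auto simp: path_def closure_subset)
      moreover have "cd ` {0<..<1} = path_image cd - {c, d}"
        using simple_path_endless[OF arc_imp_simple_path[OF A(6)]] E by simp
      moreover have "y \<in> path_image cd"
        using S mem by auto
      ultimately show ?thesis
        by (auto simp: path_image_def)
    qed
    ultimately have "y \<in> inside S"
      using S by auto
    then show False
      using not_in_inside_if_outer[of y D S] outer S by auto
  qed
  text \<open>The closed curve of \<open>p\<close> and \<open>q\<close> regrouped into two arcs from \<open>a\<close> to \<open>b\<close>: as \<open>x\<close> is
    outside both closed curves cut off by \<open>ab\<close>, the winding numbers of all three arcs about \<open>x\<close> agree.\<close>
  define p' where "p' = ac +++ reversepath bc"
  define q' where "q' = ad +++ reversepath bd"
  have p': "arc p'" "pathstart p' = a" "pathfinish p' = b" "path_image p' = path_image ac \<union> path_image bc"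
    using arc_join_props[of ac "reversepath bc"] A E int(7) by (auto simp: p'_def arc_reversepath)
  have q': "arc q'" "pathstart q' = a" "pathfinish q' = b" "path_image q' = path_image ad \<union> path_image bd"
    using arc_join_props[of ad "reversepath bd"] A E int(10) by (auto simp: q'_def arc_reversepath)
  have "x \<notin> inside (path_image p' \<union> path_image ab)"
  proof (rule half[of _ d])
    show "closed (path_image p' \<union> path_image ab)"
      by (intro closed_Un closed_arc_image A p')
    show "path_image p' \<union> path_image ab \<subseteq> D"
      unfolding p' using sub by blast
    show "(path_image p' \<union> path_image ab) \<inter> (path_image cd - {c, d}) = {}"
      unfolding p' using int(8,9,13) by blast
    show "d \<notin> path_image p' \<union> path_image ab"
      unfolding p' using int(8,9,13) mem(12) ne by blast
  qed simp
  moreover have "path_image p' \<inter> path_image ab \<subseteq> {a, b}"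
    unfolding p' using int(1,4) by blast
  ultimately have "winding_number p' x = winding_number ab x"
    using inside_two_arcs_iff_winding_number[OF p'(1) A(1) p'(2,3) E(1,2), of x] p'(4) xn by simp
  moreover have "x \<notin> inside (path_image q' \<union> path_image ab)"
  proof (rule half[of _ c])
    show "closed (path_image q' \<union> path_image ab)"
      by (intro closed_Un closed_arc_image A q')
    show "path_image q' \<union> path_image ab \<subseteq> D"
      unfolding q' using sub by blast
    show "(path_image q' \<union> path_image ab) \<inter> (path_image cd - {c, d}) = {}"
      unfolding q' using int(11,12,13) by blast
    show "c \<notin> path_image q' \<union> path_image ab"
      unfolding q' using int(11,12,13) mem(9) ne by blast
  qed simp
  moreover have "path_image q' \<inter> path_image ab \<subseteq> {a, b}"
    unfolding q' using int(2,5) by blast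
  ultimately have "winding_number p' x = winding_number q' x"
    using inside_two_arcs_iff_winding_number[OF q'(1) A(1) q'(2,3) E(1,2), of x] q'(4) xn by simp
  moreover have "path_image p' \<inter> path_image q' \<subseteq> {a, b}"
    unfolding p' q' using int(3,6,14,15) by blast
  ultimately have "x \<notin> inside (path_image p' \<union> path_image q')"
    using inside_two_arcs_iff_winding_number[OF p'(1) q'(1) p'(2,3) q'(2,3), of x] p' q' xn by auto
  moreover have "path_image p' \<union> path_image q' = path_image p \<union> path_image q"
    using p q p' q' by auto
  ultimately show False
    using inner x by auto
qed

subsection \<open>Graphs of minimum degree three\<close>

text \<open>A path \<open>v 0, v 1, \<dots>\<close> with three chords, which form a subdivision of \<open>K\<^sub>4\<close> with branch vertices
  \<open>v 0\<close>, \<open>v (i - 1)\<close>, \<open>v i\<close> and \<open>v (min j l)\<close>.\<close>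

definition K4_chords :: "'a set set \<Rightarrow> (nat \<Rightarrow> 'a) \<Rightarrow> nat \<Rightarrow> nat \<Rightarrow> nat \<Rightarrow> bool" where
  "K4_chords E v i j l \<longleftrightarrow> 2 \<le> i \<and> i < j \<and> i < l \<and> inj_on v {..max j l} \<and>
     (\<forall>k<max j l. {v k, v (Suc k)} \<in> E) \<and>
     {v 0, v i} \<in> E \<and> {v 0, v j} \<in> E \<and> {v (i - 1), v l} \<in> E"

lemma K4_chords_mono: "K4_chords E v i j l \<Longrightarrow> E \<subseteq> E' \<Longrightarrow> K4_chords E' v i j l"
  unfolding K4_chords_def by blast

definition path_list :: "'a graph \<Rightarrow> 'a list \<Rightarrow> bool" where
  "path_list G xs \<longleftrightarrow> xs \<noteq> [] \<and> distinct xs \<and> set xs \<subseteq> verts G \<and>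
     (\<forall>k. Suc k < length xs \<longrightarrow> {xs ! k, xs ! Suc k} \<in> edges G)"

lemma path_list_Cons:
  assumes "path_list G xs" "{x, xs ! 0} \<in> edges G" "x \<in> verts G" "x \<notin> set xs"
  shows "path_list G (x # xs)"
  unfolding path_list_def
proof (intro conjI allI impI)
  fix k assume "Suc k < length (x # xs)"
  then show "{(x # xs) ! k, (x # xs) ! Suc k} \<in> edges G"
    using assms by (cases k) (auto simp: path_list_def)
qed (use assms in \<open>auto simp: path_list_def\<close>)

text \<open>A rotation in the sense of Posa: the chord becomes the link between positions
  \<open>i - 1\<close> and \<open>i\<close>, the old \<open>xs ! (i - 1)\<close> becomes the start,
  and the positions from \<open>i\<close> on are unchanged.\<close>

lemma path_list_rotate:
  assumes P: "path_list G xs" and i: "0 < i" "i < length xs" "{xs ! 0, xs ! i} \<in> edges G"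
  defines "ys \<equiv> rev (take i xs) @ drop i xs"
  shows "path_list G ys"
proof -
  have lo: "ys ! k = xs ! (i - 1 - k)" if "k < i" for k
    using that i by (simp add: ys_def nth_append rev_nth)
  have hi: "ys ! k = xs ! k" if "i \<le> k" "k < length xs" for k
    using that i by (simp add: ys_def nth_append)
  have "mset ys = mset (take i xs @ drop i xs)"
    unfolding ys_def by (simp del: append_take_drop_id)
  then have "mset ys = mset xs" by simp
  then have "distinct ys" "set ys = set xs" "length ys = length xs"
    using P mset_eq_imp_distinct_iff mset_eq_setD mset_eq_length unfolding path_list_def by blast+
  moreover have "{ys ! k, ys ! Suc k} \<in> edges G" if k: "Suc k < length xs" for k
  proof -
    consider "Suc k < i" | "Suc k = i" | "i \<le> k" by linarith
    then show ?thesis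
    proof cases
      case 1
      then have "ys ! k = xs ! Suc (i - 1 - Suc k)" "ys ! Suc k = xs ! (i - 1 - Suc k)"
        using lo by (simp_all add: Suc_diff_Suc)
      moreover have "Suc (i - 1 - Suc k) < length xs"
        using 1 i by simp
      ultimately show ?thesis
        using P unfolding path_list_def by (metis insert_commute)
    next
      case 2
      then show ?thesis using lo[of k] hi[of i] i by simp
    next
      case 3
      then show ?thesis using hi k P by (simp add: path_list_def)
    qed
  qed
  ultimately show ?thesis
    using P by (auto simp: path_list_def)
qed

lemma simple_graph_edge: "simple_graph G \<Longrightarrow> {x, y} \<in> edges G \<Longrightarrow> x \<noteq> y \<and> x \<in> verts G \<and> y \<in> verts G"
  unfolding simple_graph_def by (cases "x = y") fastforce+

text \<open>Among the longest paths choose one whose first chord at the starting vertex is shortest;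
  reversing the part before that chord gives another longest path, so both starting vertices have a
  further chord beyond it.\<close>

lemma min_degree_3_imp_K4_chords:
  assumes G: "simple_graph G" and ne: "verts G \<noteq> {}"
    and deg: "\<And>x. x \<in> verts G \<Longrightarrow> 3 \<le> card {y. {x, y} \<in> edges G}"
  shows "\<exists>v i j l. K4_chords (edges G) v i j l"
proof -
  have fin: "finite (verts G)"
    using G by (simp add: simple_graph_def)
  obtain x where "x \<in> verts G" using ne by auto
  then have "path_list G [x]" by (simp add: path_list_def)
  moreover have "length xs < Suc (card (verts G))" if "path_list G xs" for xs
    using that card_mono[OF fin, of "set xs"] by (auto simp: path_list_def distinct_card)
  ultimately obtain zs where zs: "path_list G zs" "\<And>xs. path_list G xs \<Longrightarrow> length xs \<le> length zs"
    using ex_has_greatest_nat[of "path_list G" _ length] by blast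
  define L where "L = length zs"
  define Q where "Q xs \<longleftrightarrow> path_list G xs \<and> length xs = L" for xs
  \<comment> \<open>All neighbours of the start of a longest path lie on the path, since otherwise
    it could be extended. Without a chord beyond position \<open>m\<close>, only the positions 1 and
    \<open>m\<close> remain for them, too few for degree 3.\<close>
  have long: "\<exists>k>m. k < L \<and> {xs ! 0, xs ! k} \<in> edges G"
    if Q: "Q xs" and m: "\<And>k. 2 \<le> k \<Longrightarrow> k < m \<Longrightarrow> k < L \<Longrightarrow> {xs ! 0, xs ! k} \<notin> edges G" for xs m
  proof (rule ccontr)
    assume no: "\<not> ?thesis"
    have "xs ! 0 \<in> verts G"
      using Q by (auto simp: Q_def path_list_def)
    have "{y. {xs ! 0, y} \<in> edges G} \<subseteq> (!) xs ` {1, m}"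
    proof
      fix y assume "y \<in> {y. {xs ! 0, y} \<in> edges G}"
      then have y: "{xs ! 0, y} \<in> edges G" by simp
      note yG = simple_graph_edge[OF G y]
      have "y \<in> set xs"
      proof (rule ccontr)
        assume "y \<notin> set xs"
        then have "path_list G (y # xs)"
          using y yG Q by (intro path_list_Cons) (auto simp: Q_def insert_commute)
        then show False
          using zs(2) Q unfolding Q_def L_def by fastforce
      qed
      then obtain k where k: "k < L" "y = xs ! k"
        using Q by (auto simp: in_set_conv_nth Q_def)
      have "k \<noteq> 0"
        using yG k(2) by metis
      moreover have "\<not> m < k" "\<not> (2 \<le> k \<and> k < m)"
        using no m[of k] y k by blast+
      ultimately have "k \<in> {1, m}" by auto
      then show "y \<in> (!) xs ` {1, m}" using k by blast
    qed
    then have "card {y. {xs ! 0, y} \<in> edges G} \<le> card ((!) xs ` {1, m})"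
      by (intro card_mono) auto
    also have "\<dots> \<le> card {1, m}" by (rule card_image_le) simp
    also have "\<dots> \<le> 2" by (simp add: card_insert_if)
    finally show False
      using deg[OF \<open>xs ! 0 \<in> verts G\<close>] by simp
  qed
  define R where "R i \<longleftrightarrow> 2 \<le> i \<and> i < L \<and> (\<exists>xs. Q xs \<and> {xs ! 0, xs ! i} \<in> edges G)" for i
  have "Q zs" using zs by (simp add: Q_def L_def)
  \<comment> \<open>For \<open>m = 2\<close> the assumption of \<open>long\<close> is vacuous, so
    some chord exists and the least position below is well defined.\<close>
  then obtain k where "k > 2" "k < L" "{zs ! 0, zs ! k} \<in> edges G"
    using long[of zs 2] by force
  then have "R k"
    unfolding R_def using \<open>Q zs\<close> by force
  define i where "i = (LEAST i. R i)"
  have "R i" unfolding i_def using \<open>R k\<close> by (rule LeastI)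
  then obtain xs where i: "2 \<le> i" "i < L" and xs: "Q xs" "{xs ! 0, xs ! i} \<in> edges G"
    by (auto simp: R_def)
  \<comment> \<open>The position \<open>i\<close> is minimal over all longest paths, not only for
    \<open>xs\<close>; hence \<open>long\<close> applies to the rotated path as well.\<close>
  have short: "{ys ! 0, ys ! k} \<notin> edges G" if "Q ys" "2 \<le> k" "k < i" "k < L" for ys k
    using that not_less_Least[of k R] unfolding i_def R_def by blast
  obtain j where j: "i < j" "j < L" "{xs ! 0, xs ! j} \<in> edges G"
    using long[OF xs(1), of i] short[OF xs(1)] by blast
  define ys where "ys = rev (take i xs) @ drop i xs"
  have len: "length xs = L" using xs by (simp add: Q_def)
  have ys: "Q ys"
    using path_list_rotate[of G xs i] xs i by (auto simp: Q_def ys_def)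
  obtain l where l: "i < l" "l < L" "{ys ! 0, ys ! l} \<in> edges G"
    using long[OF ys, of i] short[OF ys] by blast
  \<comment> \<open>Since \<open>l\<close> exceeds \<open>i\<close>, the rotation does not move
    position \<open>l\<close>, and the chord of \<open>ys\<close> is a chord of \<open>xs\<close>
    from position \<open>i - 1\<close>.\<close>
  have "ys ! 0 = xs ! (i - 1)" "ys ! l = xs ! l"
    using i l len by (simp_all add: ys_def nth_append rev_nth)
  moreover have "inj_on ((!) xs) {..max j l}"
    using xs j l by (intro inj_on_nth) (auto simp: Q_def path_list_def)
  moreover have "\<forall>k<max j l. {xs ! k, xs ! Suc k} \<in> edges G"
    using xs(1) j l by (auto simp: Q_def path_list_def less_max_iff_disj)
  ultimately have "K4_chords (edges G) ((!) xs) i j l"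
    using i j l xs by (simp add: K4_chords_def)
  then show ?thesis by blast
qed

section \<open>Counting edges by deleting vertices of small degree\<close>

lemma finite_edges: "simple_graph G \<Longrightarrow> finite (edges G)"
  unfolding simple_graph_def by (meson Pow_iff finite_Pow_iff rev_finite_subset subsetI)

text \<open>Some vertex has degree at most two, since minimum degree three would yield the chords.
  Deleting it removes at most two edges and creates no new chords; two vertices span at most one
  edge.\<close>

lemma card_edges_le_if_no_K4_chords:
  assumes "simple_graph G" "2 \<le> card (verts G)" "\<nexists>v i j l. K4_chords (edges G) v i j l"
  shows "card (edges G) \<le> 2 * card (verts G) - 3"
  using assms
proof (induction "card (verts G)" arbitrary: G rule: less_induct)
  case less
  have fin: "finite (verts G)" and E: "\<And>e. e \<in> edges G \<Longrightarrow> e \<subseteq> verts G \<and> card e = 2"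
    using less.prems by (auto simp: simple_graph_def)
  show ?case
  proof (cases "card (verts G) = 2")
    case True
    then have "edges G \<subseteq> {verts G}"
      using E card_subset_eq[OF fin] by (metis singletonI subsetI)
    then have "card (edges G) \<le> card {verts G}"
      by (intro card_mono) auto
    then show ?thesis using True by simp
  next
    case False
    then have c3: "3 \<le> card (verts G)" using less.prems by simp
    then have "verts G \<noteq> {}" by auto
    then obtain x where x: "x \<in> verts G" "card {y. {x, y} \<in> edges G} \<le> 2"
      using min_degree_3_imp_K4_chords[OF less.prems(1)] less.prems(3) by force
    define G' where "G' = (verts G - {x}, {e \<in> edges G. x \<notin> e})"
    have G': "simple_graph G'" "card (verts G') = card (verts G) - 1"
      using less.prems(1) x fin by (auto simp: G'_def simple_graph_def)
    have "card (edges G') \<le> 2 * card (verts G') - 3"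
      using less.prems(3) c3 G' K4_chords_mono[of "edges G'" _ _ _ _ "edges G"]
      by (intro less.hyps) (auto simp: G'_def)
    moreover have "edges G \<subseteq> edges G' \<union> (\<lambda>y. {x, y}) ` {y. {x, y} \<in> edges G}"
    proof
      fix e assume e: "e \<in> edges G"
      show "e \<in> edges G' \<union> (\<lambda>y. {x, y}) ` {y. {x, y} \<in> edges G}"
      proof (cases "x \<in> e")
        case True
        then obtain y where "e = {x, y}"
          using E[OF e] by (auto simp: card_2_iff)
        then show ?thesis using e by auto
      qed (use e in \<open>simp add: G'_def\<close>)
    qed
    moreover have fN: "finite {y. {x, y} \<in> edges G}"
      using fin E by (rule_tac finite_subset) auto
    ultimately have "card (edges G) \<le> card (edges G') + card ((\<lambda>y. {x, y}) ` {y. {x, y} \<in> edges G})"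
      using finite_edges[OF G'(1)] by (meson card_Un_le card_mono finite_Un finite_imageI le_trans)
    also have "card ((\<lambda>y. {x, y}) ` {y. {x, y} \<in> edges G}) \<le> 2"
      using card_image_le[OF fN, of "\<lambda>y. {x, y}"] x(2) by linarith
    finally show ?thesis
      using \<open>card (edges G') \<le> _\<close> G'(2) c3 by simp
  qed
qed

subsection \<open>The number of edges of an outerplanar graph\<close>

text \<open>A path is recorded by its edge set because intersections of drawn paths are read off
  from the vertices their edges cover. The freshness condition in \<open>snoc\<close> keeps the
  drawn path an arc.\<close>

inductive path_edges :: "'a set set \<Rightarrow> 'a \<Rightarrow> 'a \<Rightarrow> 'a set set \<Rightarrow> bool" for E where
  edge: "{u, w} \<in> E \<Longrightarrow> path_edges E u w {{u, w}}"
| snoc: "path_edges E u w F \<Longrightarrow> {w, x} \<in> E \<Longrightarrow> x \<notin> \<Union>F \<Longrightarrow> path_edges E u x (insert {w, x} F)"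

lemma path_edges_subset: "path_edges E u w F \<Longrightarrow> F \<subseteq> E"
  by (induction rule: path_edges.induct) auto

definition edge_images :: "('a set \<Rightarrow> real \<Rightarrow> complex) \<Rightarrow> 'a set set \<Rightarrow> complex set" where
  "edge_images c F = (\<Union>e\<in>F. path_image (c e))"

lemma edge_images_Int:
  assumes "planar_embedding G z c" "F \<subseteq> edges G" "F' \<subseteq> edges G" "F \<inter> F' = {}"
  shows "edge_images c F \<inter> edge_images c F' \<subseteq> z ` (\<Union>F \<inter> \<Union>F')"
proof
  fix w assume "w \<in> edge_images c F \<inter> edge_images c F'"
  then obtain e e' where e: "e \<in> F" "e' \<in> F'" "w \<in> path_image (c e) \<inter> path_image (c e')"
    by (auto simp: edge_images_def)
  then have "e \<in> edges G" "e' \<in> edges G" "e \<noteq> e'" using assms by auto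
  then have "w \<in> z ` (e \<inter> e')"
    using assms(1) e(3) unfolding planar_embedding_def by blast
  then show "w \<in> z ` (\<Union>F \<inter> \<Union>F')" using e by blast
qed

lemma arc_between_reversepath: "arc_between a b p \<Longrightarrow> arc_between b a (reversepath p)"
  by (simp add: arc_between_def arc_reversepath)

lemma arc_of_edge:
  assumes "planar_embedding G z c" "{u, w} \<in> edges G"
  obtains g where "arc_between (z u) (z w) g" "path_image g = path_image (c {u, w})"
proof -
  have c: "arc (c {u, w})" "{pathstart (c {u, w}), pathfinish (c {u, w})} = {z u, z w}"
    using assms by (auto simp: planar_embedding_def)
  then consider "arc_between (z u) (z w) (c {u, w})" | "arc_between (z w) (z u) (c {u, w})"
    by (auto simp: arc_between_def doubleton_eq_iff)
  then show thesis
  proof cases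
    case 1
    then show thesis using that by blast
  next
    case 2
    then show thesis
      using that[of "reversepath (c {u, w})"] by (simp add: arc_between_reversepath)
  qed
qed

text \<open>The arcs of the edges are concatenated. The new end \<open>x\<close> is on no earlier
  edge, so the arc of the last edge can meet the previous ones only at \<open>z w\<close>.\<close>

lemma arc_of_path_edges:
  assumes emb: "planar_embedding G z c" and "path_edges (edges G) u w F"
  shows "\<exists>g. arc_between (z u) (z w) g \<and> path_image g \<subseteq> edge_images c F"
  using assms(2)
proof (induction rule: path_edges.induct)
  case (edge u w)
  then show ?case
    using arc_of_edge[OF emb] by (metis (no_types, lifting) UN_insert edge_images_def sup_ge1)
next
  case (snoc u w F x)
  obtain g where g: "arc_between (z u) (z w) g" "path_image g \<subseteq> edge_images c F"
    using snoc.IH by blast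
  obtain h where h: "arc_between (z w) (z x) h" "path_image h = path_image (c {w, x})"
    by (rule arc_of_edge[OF emb snoc.hyps(2)])
  have h': "path_image h = edge_images c {{w, x}}"
    using h by (simp add: edge_images_def)
  have "{w, x} \<notin> F" using snoc.hyps(3) by auto
  then have "edge_images c F \<inter> edge_images c {{w, x}} \<subseteq> z ` (\<Union>F \<inter> \<Union>{{w, x}})"
    using snoc.hyps(2) by (intro edge_images_Int[OF emb path_edges_subset[OF snoc.hyps(1)]]) simp_all
  then have "path_image g \<inter> path_image h \<subseteq> z ` (\<Union>F \<inter> \<Union>{{w, x}})"
    using g(2) unfolding h' by (meson Int_mono order_refl order_trans)
  also have "\<dots> \<subseteq> {z w}" using snoc.hyps(3) by auto
  finally have "arc_between (z u) (z x) (g +++ h) \<and> path_image (g +++ h) = path_image g \<union> path_image h"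
    using arc_join_props[of g h] g h by (simp add: arc_between_def)
  moreover have "path_image g \<union> path_image h \<subseteq> edge_images c (insert {w, x} F)"
    using g(2) h(2) by (auto simp: edge_images_def)
  ultimately show ?case by metis
qed

text \<open>A common edge would contribute two common vertices, so sharing at most one vertex
  already makes the edge sets disjoint.\<close>

lemma edge_images_Int_le:
  assumes "planar_embedding G z c" "simple_graph G" "F \<subseteq> edges G" "F' \<subseteq> edges G"
    and U: "\<Union>F \<inter> \<Union>F' \<subseteq> {x}"
  shows "edge_images c F \<inter> edge_images c F' \<subseteq> z ` (\<Union>F \<inter> \<Union>F')"
proof (rule edge_images_Int[OF assms(1,3,4)])
  have "e \<notin> F'" if "e \<in> F" for e
  proof
    assume "e \<in> F'"
    then have "e \<subseteq> {x}" using U that by blast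
    then have "card e \<le> 1" using card_mono[of "{x}" e] by simp
    moreover have "card e = 2"
      using assms(2,3) that unfolding simple_graph_def by blast
    ultimately show False by simp
  qed
  then show "F \<inter> F' = {}" by blast
qed

section \<open>Drawing the subdivision of K4 given by a path and three chords\<close>

definition segment_edges :: "(nat \<Rightarrow> 'a) \<Rightarrow> nat \<Rightarrow> nat \<Rightarrow> 'a set set" where
  "segment_edges v s t = (\<lambda>k. {v k, v (Suc k)}) ` {s..<t}"

lemma Union_segment_edges: "s < t \<Longrightarrow> \<Union>(segment_edges v s t) = v ` {s..t}"
proof (induction t)
  case (Suc t)
  have *: "segment_edges v s (Suc t) = insert {v t, v (Suc t)} (segment_edges v s t)"
    using Suc.prems by (simp add: segment_edges_def atLeastLessThanSuc)
  show ?case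
  proof (cases "s < t")
    case True
    then show ?thesis
      unfolding * using Suc.IH by (auto simp: atLeastAtMostSuc_conv)
  next
    case False
    then have "s = t" using Suc.prems by simp
    then show ?thesis unfolding * by (auto simp: segment_edges_def atLeastAtMostSuc_conv)
  qed
qed simp

lemma path_edges_segment:
  assumes "s < t" "inj_on v {s..t}" "\<forall>k\<in>{s..<t}. {v k, v (Suc k)} \<in> E"
  shows "path_edges E (v s) (v t) (segment_edges v s t)"
  using assms
proof (induction t)
  case (Suc t)
  have *: "segment_edges v s (Suc t) = insert {v t, v (Suc t)} (segment_edges v s t)"
    using Suc.prems by (simp add: segment_edges_def atLeastLessThanSuc)
  show ?case
  proof (cases "s < t")
    case True
    have "path_edges E (v s) (v t) (segment_edges v s t)"
      using Suc True inj_on_subset[OF Suc.prems(2), of "{s..t}"] by auto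
    moreover have "v (Suc t) \<notin> \<Union>(segment_edges v s t)"
      using inj_on_image_mem_iff[OF Suc.prems(2), of "Suc t" "{s..t}"] Suc.prems(1)
      unfolding Union_segment_edges[OF True] by auto
    ultimately show ?thesis
      unfolding * using Suc.prems(1,3) by (intro path_edges.snoc) auto
  next
    case False
    then have "s = t" using Suc.prems by simp
    then show ?thesis
      unfolding * using Suc.prems by (auto simp: segment_edges_def intro: path_edges.edge)
  qed
qed simp

text \<open>These paths run forward from the branch vertex \<open>v s\<close> and return by a chord
  to an earlier vertex. For \<open>s = t\<close> the segment is empty and only the chord is
  left.\<close>

lemma path_edges_segment_chord:
  assumes "s \<le> t" "inj_on v {..t}" "\<forall>k\<in>{s..<t}. {v k, v (Suc k)} \<in> E" "{v t, v r} \<in> E" "r < s"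
  shows "path_edges E (v s) (v r) (insert {v t, v r} (segment_edges v s t))"
    and "\<Union>(insert {v t, v r} (segment_edges v s t)) = v ` insert r {s..t}"
proof -
  show U: "\<Union>(insert {v t, v r} (segment_edges v s t)) = v ` insert r {s..t}"
  proof (cases "s = t")
    case True
    then show ?thesis by (auto simp: segment_edges_def)
  next
    case False
    then show ?thesis using assms(1) Union_segment_edges[of s t v] by auto
  qed
  show "path_edges E (v s) (v r) (insert {v t, v r} (segment_edges v s t))"
  proof (cases "s = t")
    case True
    then show ?thesis using assms by (auto simp: segment_edges_def intro: path_edges.edge)
  next
    case False
    then have "s < t" using assms(1) by simp
    moreover have "inj_on v {s..t}"
      using assms(2) by (rule inj_on_subset) auto
    moreover have "v r \<notin> v ` {s..t}"
      using assms by (subst inj_on_image_mem_iff[OF assms(2)]) auto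
    ultimately show ?thesis
      using assms by (intro path_edges.snoc path_edges_segment) (simp_all add: Union_segment_edges)
  qed
qed

lemma K4_chords_not_outerplanar:
  assumes G: "simple_graph G" and K: "K4_chords (edges G) v i j l"
  shows "\<not> outerplanar G"
proof
  assume "outerplanar G"
  then obtain z c where emb: "planar_embedding G z c"
    and outer: "z ` verts G \<subseteq> frontier (outside (drawing G z c))"
    by (auto simp: outerplanar_def)
  define m where "m = min j l"
  have i: "2 \<le> i" "i < m" "i < j" "i < l" "m \<le> j" "m \<le> l" "m = j \<or> m = l"
    and inj: "inj_on v {..max j l}"
    and step: "\<And>k. k < max j l \<Longrightarrow> {v k, v (Suc k)} \<in> edges G"
    and chord: "{v 0, v i} \<in> edges G" "{v j, v 0} \<in> edges G" "{v l, v (i - 1)} \<in> edges G"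
    using K by (auto simp: K4_chords_def m_def insert_commute)
  \<comment> \<open>The branch vertices are a = \<open>v 0\<close>, b = \<open>v (i - 1)\<close>, c
    = \<open>v i\<close> and d = \<open>v m\<close>; they are distinct because
    \<open>2 \<le> i\<close> and \<open>i < m\<close>. As \<open>m\<close> is \<open>j\<close> or
    \<open>l\<close>, one of \<open>da\<close> and \<open>db\<close> is a bare chord, so these two
    paths share only \<open>v m\<close>.\<close>
  define ab ac da bc db cd where "ab = segment_edges v 0 (i - 1)" and "ac = {{v 0, v i}}"
    and "da = insert {v j, v 0} (segment_edges v m j)" and "bc = segment_edges v (i - 1) i"
    and "db = insert {v l, v (i - 1)} (segment_edges v m l)" and "cd = segment_edges v i m"
  have injs: "inj_on v {s..t}" if "t \<le> max j l" for s t
    using inj by (rule inj_on_subset) (use that in auto)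
  have idx: "2 \<le> i" "i < m" "m \<le> max j l" "j \<le> max j l" "l \<le> max j l" "m = j \<or> m = l"
    using i by auto
  have U: "\<Union>ab = v ` {0..i - 1}" "\<Union>ac = v ` {0, i}" "\<Union>da = v ` insert 0 {m..j}"
    "\<Union>bc = v ` {i - 1..i}" "\<Union>db = v ` insert (i - 1) {m..l}" "\<Union>cd = v ` {i..m}"
  proof -
    show "\<Union>ab = v ` {0..i - 1}" "\<Union>bc = v ` {i - 1..i}" "\<Union>cd = v ` {i..m}"
      using i unfolding ab_def bc_def cd_def by (simp_all add: Union_segment_edges)
    show "\<Union>ac = v ` {0, i}" by (simp add: ac_def)
    show "\<Union>da = v ` insert 0 {m..j}" unfolding da_def
      by (rule path_edges_segment_chord(2)[where E = "edges G"]) (use i step chord injs[of j 0] in \<open>auto simp: atMost_atLeast0\<close>)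
    show "\<Union>db = v ` insert (i - 1) {m..l}" unfolding db_def
      by (rule path_edges_segment_chord(2)[where E = "edges G"]) (use i step chord injs[of l 0] in \<open>auto simp: atMost_atLeast0\<close>)
  qed
  have P: "path_edges (edges G) (v 0) (v (i - 1)) ab" "path_edges (edges G) (v 0) (v i) ac"
    "path_edges (edges G) (v m) (v 0) da" "path_edges (edges G) (v (i - 1)) (v i) bc"
    "path_edges (edges G) (v m) (v (i - 1)) db" "path_edges (edges G) (v i) (v m) cd"
  proof -
    show "path_edges (edges G) (v 0) (v (i - 1)) ab" "path_edges (edges G) (v (i - 1)) (v i) bc"
      "path_edges (edges G) (v i) (v m) cd"
      unfolding ab_def bc_def cd_def
      by (rule path_edges_segment; use i step injs in auto)+
    show "path_edges (edges G) (v 0) (v i) ac"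
      unfolding ac_def using chord(1) by (rule path_edges.edge)
    show "path_edges (edges G) (v m) (v 0) da" unfolding da_def
      by (rule path_edges_segment_chord(1)) (use i step chord injs[of j 0] in \<open>auto simp: atMost_atLeast0\<close>)
    show "path_edges (edges G) (v m) (v (i - 1)) db" unfolding db_def
      by (rule path_edges_segment_chord(1)) (use i step chord injs[of l 0] in \<open>auto simp: atMost_atLeast0\<close>)
  qed
  note S = P[THEN path_edges_subset]
  have B: "{0..i - 1} \<subseteq> {..max j l}" "{0, i} \<subseteq> {..max j l}" "insert 0 {m..j} \<subseteq> {..max j l}"
    "{i - 1..i} \<subseteq> {..max j l}" "insert (i - 1) {m..l} \<subseteq> {..max j l}" "{i..m} \<subseteq> {..max j l}"
    using i by auto
  \<comment> \<open>Injectivity of \<open>v\<close> turns the intersection of two drawn paths into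
    an intersection of index sets, which arithmetic settles in each of the fifteen cases.\<close>
  have Int: "edge_images c A \<inter> edge_images c A' \<subseteq> z ` v ` (I \<inter> J)"
    if "\<Union>A = v ` I" "\<Union>A' = v ` J" "A \<subseteq> edges G" "A' \<subseteq> edges G" "I \<subseteq> {..max j l}" "J \<subseteq> {..max j l}"
      "I \<inter> J \<subseteq> {x}" for A A' I J x
  proof -
    have eq: "\<Union>A \<inter> \<Union>A' = v ` (I \<inter> J)"
      unfolding that(1,2) using inj_on_image_Int[OF inj that(5,6)] by simp
    then have "\<Union>A \<inter> \<Union>A' \<subseteq> {v x}" using that(7) by auto
    then show ?thesis
      using edge_images_Int_le[OF emb G that(3,4)] unfolding eq by blast
  qed
  have Int1: "path_image g \<inter> path_image h \<subseteq> {z (v x)}"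
    if "path_image g \<subseteq> edge_images c A" "path_image h \<subseteq> edge_images c A'"
      "\<Union>A = v ` I" "\<Union>A' = v ` J" "A \<subseteq> edges G" "A' \<subseteq> edges G" "I \<subseteq> {..max j l}" "J \<subseteq> {..max j l}"
      "I \<inter> J \<subseteq> {x}" for g h A A' I J x
    by (rule subset_trans[OF Int_mono[OF that(1,2)] subset_trans[OF Int[OF that(3-9)]]]) (use that(9) in auto)
  have Int0: "path_image g \<inter> path_image h = {}"
    if "path_image g \<subseteq> edge_images c A" "path_image h \<subseteq> edge_images c A'"
      "\<Union>A = v ` I" "\<Union>A' = v ` J" "A \<subseteq> edges G" "A' \<subseteq> edges G" "I \<subseteq> {..max j l}" "J \<subseteq> {..max j l}"
      "I \<inter> J = {}" for g h A A' I J
  proof -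
    \<comment> \<open>Any singleton would do as the bound that \<open>Int\<close> asks for.\<close>
    have "I \<inter> J \<subseteq> {0}" using that(9) by simp
    then have "edge_images c A \<inter> edge_images c A' \<subseteq> {}"
      using Int[OF that(3-8)] unfolding that(9) by simp
    then show ?thesis using that(1,2) by blast
  qed
  obtain gab where ab: "arc_between (z (v 0)) (z (v (i - 1))) gab" "path_image gab \<subseteq> edge_images c ab"
    using arc_of_path_edges[OF emb P(1)] by blast
  obtain gac where ac: "arc_between (z (v 0)) (z (v i)) gac" "path_image gac \<subseteq> edge_images c ac"
    using arc_of_path_edges[OF emb P(2)] by blast
  obtain gda where da: "arc_between (z (v m)) (z (v 0)) gda" "path_image gda \<subseteq> edge_images c da"
    using arc_of_path_edges[OF emb P(3)] by blast
  obtain gbc where bc: "arc_between (z (v (i - 1))) (z (v i)) gbc" "path_image gbc \<subseteq> edge_images c bc"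
    using arc_of_path_edges[OF emb P(4)] by blast
  obtain gdb where db: "arc_between (z (v m)) (z (v (i - 1))) gdb" "path_image gdb \<subseteq> edge_images c db"
    using arc_of_path_edges[OF emb P(5)] by blast
  obtain gcd where cd: "arc_between (z (v i)) (z (v m)) gcd" "path_image gcd \<subseteq> edge_images c cd"
    using arc_of_path_edges[OF emb P(6)] by blast
  have "v 0 \<in> verts G" "v i \<in> verts G" "v (i - 1) \<in> verts G" "v m \<in> verts G"
    using chord simple_graph_edge[OF G] i(7) by metis+
  then have ends: "{z (v 0), z (v (i - 1)), z (v i), z (v m)} \<subseteq> frontier (outside (drawing G z c))"
    using outer by blast
  have D: "edge_images c A \<subseteq> drawing G z c" if "A \<subseteq> edges G" for A
    using that by (auto simp: edge_images_def drawing_def)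
  show False
  proof (rule no_outer_K4[OF ab(1) ac(1) arc_between_reversepath[OF da(1)] bc(1)
        arc_between_reversepath[OF db(1)] cd(1) _ _ _ _ _ _ _ _ _ _ _ _ _ _ _ _ ends], unfold path_image_reversepath)
    show "path_image gab \<inter> path_image gac \<subseteq> {z (v 0)}"
      by (rule Int1[OF ab(2) ac(2) U(1,2) S(1,2) B(1,2)]) (use idx in auto)
    show "path_image gab \<inter> path_image gda \<subseteq> {z (v 0)}"
      by (rule Int1[OF ab(2) da(2) U(1,3) S(1,3) B(1,3)]) (use idx in auto)
    show "path_image gac \<inter> path_image gda \<subseteq> {z (v 0)}"
      by (rule Int1[OF ac(2) da(2) U(2,3) S(2,3) B(2,3)]) (use idx in auto)
    show "path_image gab \<inter> path_image gbc \<subseteq> {z (v (i - 1))}"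
      by (rule Int1[OF ab(2) bc(2) U(1,4) S(1,4) B(1,4)]) (use idx in auto)
    show "path_image gab \<inter> path_image gdb \<subseteq> {z (v (i - 1))}"
      by (rule Int1[OF ab(2) db(2) U(1,5) S(1,5) B(1,5)]) (use idx in auto)
    show "path_image gbc \<inter> path_image gdb \<subseteq> {z (v (i - 1))}"
      by (rule Int1[OF bc(2) db(2) U(4,5) S(4,5) B(4,5)]) (use idx in auto)
    show "path_image gac \<inter> path_image gbc \<subseteq> {z (v i)}"
      by (rule Int1[OF ac(2) bc(2) U(2,4) S(2,4) B(2,4)]) (use idx in auto)
    show "path_image gac \<inter> path_image gcd \<subseteq> {z (v i)}"
      by (rule Int1[OF ac(2) cd(2) U(2,6) S(2,6) B(2,6)]) (use idx in auto)
    show "path_image gbc \<inter> path_image gcd \<subseteq> {z (v i)}"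
      by (rule Int1[OF bc(2) cd(2) U(4,6) S(4,6) B(4,6)]) (use idx in auto)
    show "path_image gda \<inter> path_image gdb \<subseteq> {z (v m)}"
      by (rule Int1[OF da(2) db(2) U(3,5) S(3,5) B(3,5)]) (use idx in auto)
    show "path_image gda \<inter> path_image gcd \<subseteq> {z (v m)}"
      by (rule Int1[OF da(2) cd(2) U(3,6) S(3,6) B(3,6)]) (use idx in auto)
    show "path_image gdb \<inter> path_image gcd \<subseteq> {z (v m)}"
      by (rule Int1[OF db(2) cd(2) U(5,6) S(5,6) B(5,6)]) (use idx in auto)
    show "path_image gab \<inter> path_image gcd = {}"
      by (rule Int0[OF ab(2) cd(2) U(1,6) S(1,6) B(1,6)]) (use idx in auto)
    show "path_image gac \<inter> path_image gdb = {}"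
      by (rule Int0[OF ac(2) db(2) U(2,5) S(2,5) B(2,5)]) (use idx in auto)
    show "path_image gda \<inter> path_image gbc = {}"
      by (rule Int0[OF da(2) bc(2) U(3,4) S(3,4) B(3,4)]) (use idx in auto)
    show "path_image gab \<union> path_image gac \<union> path_image gda \<union> path_image gbc \<union> path_image gdb
        \<union> path_image gcd \<subseteq> drawing G z c"
      using ab(2) ac(2) da(2) bc(2) db(2) cd(2) S[THEN D] by blast
  qed
qed

lemma card_edges_outerplanar_le:
  assumes "simple_graph G" "outerplanar G" "2 \<le> card (verts G)"
  shows "card (edges G) \<le> 2 * card (verts G) - 3"
  using card_edges_le_if_no_K4_chords K4_chords_not_outerplanar assms by blast

subsection \<open>The square of a path\<close>

definition path_square :: "nat \<Rightarrow> nat graph" where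
  "path_square n = ({..<n}, {{i, j} | i j. i < j \<and> j \<le> i + 2 \<and> j < n})"

text \<open>Even vertices lie on the lower and odd vertices on the upper boundary line of a strip of
  height 1. Edges \<open>{i, i + 2}\<close> run along these lines and edges
  \<open>{i, i + 1}\<close> cross the strip.\<close>

definition zigzag :: "nat \<Rightarrow> complex" where
  "zigzag i = Complex (real i) (of_bool (odd i))"

lemma simple_graph_path_square: "simple_graph (path_square n)"
  by (auto simp: simple_graph_def path_square_def)

lemma card_edges_path_square:
  assumes "2 \<le> n"
  shows "card (edges (path_square n)) = 2 * n - 3"
proof -
  have "edges (path_square n) = (\<lambda>i. {i, i + 1}) ` {..<n - 1} \<union> (\<lambda>i. {i, i + 2}) ` {..<n - 2}"
  proof (intro equalityI subsetI)
    fix e assume "e \<in> edges (path_square n)"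
    then obtain i j where e: "e = {i, j}" "i < j" "j \<le> i + 2" "j < n"
      by (auto simp: path_square_def)
    then have "j = i + 1 \<and> i \<in> {..<n - 1} \<or> j = i + 2 \<and> i \<in> {..<n - 2}" by auto
    then show "e \<in> (\<lambda>i. {i, i + 1}) ` {..<n - 1} \<union> (\<lambda>i. {i, i + 2}) ` {..<n - 2}"
      unfolding e(1) by blast
  next
    fix e assume "e \<in> (\<lambda>i. {i, i + 1}) ` {..<n - 1} \<union> (\<lambda>i. {i, i + 2}) ` {..<n - 2}"
    then obtain i d where e: "e = {i, i + d}" "0 < d" "d \<le> 2" "i + d < n"
      by fastforce
    then have "i < i + d \<and> i + d \<le> i + 2 \<and> i + d < n" by simp
    then show "e \<in> edges (path_square n)"
      unfolding path_square_def e(1) snd_conv by blast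
  qed
  moreover have "card ((\<lambda>i::nat. {i, i + 1}) ` {..<n - 1}) = n - 1"
    by (subst card_image) (auto simp: inj_on_def doubleton_eq_iff)
  moreover have "card ((\<lambda>i::nat. {i, i + 2}) ` {..<n - 2}) = n - 2"
    by (subst card_image) (auto simp: inj_on_def doubleton_eq_iff)
  moreover have "(\<lambda>i::nat. {i, i + 1}) ` {..<n - 1} \<inter> (\<lambda>i. {i, i + 2}) ` {..<n - 2} = {}"
    by (auto simp: doubleton_eq_iff)
  ultimately show ?thesis
    using assms by (simp add: card_Un_disjoint)
qed

section \<open>Excluding the double star\<close>

lemma path_square_edge:
  assumes "{x, y} \<in> edges (path_square n)"
  shows "x \<noteq> y" "x \<le> y + 2" "y \<le> x + 2"
  using assms by (auto simp: path_square_def doubleton_eq_iff)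

text \<open>For \<open>q \<ge> 4\<close> the centre \<open>y\<close> would have at least five
  neighbours within distance two on the number line. Otherwise \<open>p = q = 3\<close>, and six
  leaves would have to fit into a window of at most seven integers that also contains both
  centres.\<close>

lemma free_of_double_star_path_square:
  assumes "p \<le> q" "3 \<le> p \<or> 4 \<le> q"
  shows "free_of (double_star p q) (path_square n)"
  unfolding free_of_def
proof
  assume "\<exists>K. is_subgraph K (path_square n) \<and> graph_iso (double_star p q) K"
  then obtain K f where K: "is_subgraph K (path_square n)"
    and f: "bij_betw f (verts (double_star p q)) (verts K)"
      "(\<lambda>e. f ` e) ` edges (double_star p q) = edges K"
    by (auto simp: graph_iso_def)
  have inj: "inj_on f (verts (double_star p q))"
    using f(1) by (simp add: bij_betw_def)
  have edge: "{f u, f w} \<in> edges (path_square n)" if "{u, w} \<in> edges (double_star p q)" for u w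
  proof -
    have "f ` {u, w} \<in> edges K" using that f(2) by blast
    then show ?thesis using K by (auto simp: is_subgraph_def)
  qed
  define x y X Y where "x = f CentreX" and "y = f CentreY"
    and "X = f ` LeafX ` {..<p}" and "Y = f ` LeafY ` {..<q}"
  have xy: "{x, y} \<in> edges (path_square n)"
    unfolding x_def y_def by (rule edge) (simp add: double_star_def)
  have X: "{x, u} \<in> edges (path_square n)" if "u \<in> X" for u
    using that unfolding x_def X_def by (auto intro!: edge simp: double_star_def)
  have Y: "{y, u} \<in> edges (path_square n)" if "u \<in> Y" for u
    using that unfolding y_def Y_def by (auto intro!: edge simp: double_star_def)
  have sub: "CentreX \<in> verts (double_star p q)" "CentreY \<in> verts (double_star p q)"
    "LeafX ` {..<p} \<subseteq> verts (double_star p q)" "LeafY ` {..<q} \<subseteq> verts (double_star p q)"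
    by (auto simp: double_star_def)
  have cX: "card X = p"
    unfolding X_def using inj_on_subset[OF inj sub(3)] by (simp add: card_image inj_on_def)
  have cY: "card Y = q"
    unfolding Y_def using inj_on_subset[OF inj sub(4)] by (simp add: card_image inj_on_def)
  have XY: "X \<inter> Y = {}"
    unfolding X_def Y_def using inj_on_image_Int[OF inj sub(3,4)] by auto
  have nin: "x \<notin> Y" "y \<notin> X"
    unfolding x_def y_def X_def Y_def using inj_on_image_mem_iff[OF inj] sub by auto
  have fin: "finite X" "finite Y" by (simp_all add: X_def Y_def)
  note e = path_square_edge[OF xy]
  show False
  proof (cases "4 \<le> q")
    case True
    \<comment> \<open>Truncated subtraction only shortens the interval near 0, so the upper bounds
      on its size remain valid.\<close>
    have "insert x Y \<subseteq> {y - 2..y + 2} - {y}"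
      using path_square_edge[OF Y] e by force
    then have "card (insert x Y) \<le> card ({y - 2..y + 2} - {y})"
      by (intro card_mono) auto
    also have "\<dots> \<le> 4" by (simp add: card_Diff_singleton)
    finally show False using True cY nin fin by simp
  next
    case False
    then have pq: "p = 3" "q = 3" using assms by auto
    define lo hi where "lo = min x y" and "hi = max x y"
    have lh: "lo < hi" "hi \<le> lo + 2" "{lo, hi} = {x, y}"
      using e by (auto simp: lo_def hi_def)
    have "X \<union> Y \<subseteq> {lo - 2..hi + 2} - {lo, hi}"
    proof
      fix u assume u: "u \<in> X \<union> Y"
      then have "u \<noteq> x" "u \<noteq> y" "x \<le> u + 2 \<or> y \<le> u + 2" "u \<le> x + 2 \<or> u \<le> y + 2"
        using path_square_edge[OF X, of u] path_square_edge[OF Y, of u] nin by auto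
      then show "u \<in> {lo - 2..hi + 2} - {lo, hi}"
        unfolding lh(3) by (auto simp: lo_def hi_def)
    qed
    then have "card (X \<union> Y) \<le> card ({lo - 2..hi + 2} - {lo, hi})"
      by (intro card_mono) auto
    also have "\<dots> = card {lo - 2..hi + 2} - 2"
    proof -
      have "lo \<in> {lo - 2..hi + 2}" "hi \<in> {lo - 2..hi + 2}" "card {lo, hi} = 2"
        using lh(1,2) by auto
      then show ?thesis by (subst card_Diff_subset) auto
    qed
    also have "\<dots> \<le> 5" using lh by auto
    finally show False
      using pq cX cY XY fin by (simp add: card_Un_disjoint)
  qed
qed

section \<open>Straight-line drawing in a strip\<close>

lemma zigzag_segment:
  assumes "w \<in> closed_segment (zigzag i) (zigzag (i + d))"
  obtains t where "0 \<le> t" "t \<le> 1" "Re w = real i + t * real d"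
    "Im w = (if even d then of_bool (odd i) else if odd i then 1 - t else t)"
    "t = 0 \<longrightarrow> w = zigzag i" "t = 1 \<longrightarrow> w = zigzag (i + d)"
proof -
  obtain t where t: "0 \<le> t" "t \<le> 1" and w: "w = (1 - t) *\<^sub>R zigzag i + t *\<^sub>R zigzag (i + d)"
    using assms by (auto simp: closed_segment_def)
  show thesis
  proof (rule that[of t])
    show "Re w = real i + t * real d"
      by (simp add: w zigzag_def algebra_simps)
    show "Im w = (if even d then of_bool (odd i) else if odd i then 1 - t else t)"
      by (simp add: w zigzag_def)
  qed (use t w in auto)
qed

text \<open>The real part confines \<open>k\<close> to the range from \<open>i\<close> to
  \<open>i + d\<close>. The only other candidate is \<open>i + 1\<close> for \<open>d = 2\<close>,
  and it lies on the opposite boundary line.\<close>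

lemma zigzag_in_segment:
  assumes "zigzag k \<in> closed_segment (zigzag i) (zigzag (i + d))" "d \<in> {1, 2}"
  shows "k \<in> {i, i + d}"
proof -
  obtain t where t: "0 \<le> t" "t \<le> 1" "Re (zigzag k) = real i + t * real d"
    "Im (zigzag k) = (if even d then of_bool (odd i) else if odd i then 1 - t else t)"
    by (rule zigzag_segment[OF assms(1)])
  have "0 \<le> t * real d" "t * real d \<le> real d"
    using t(1,2) by (auto intro: mult_left_le_one_le)
  then have "real i \<le> real k" "real k \<le> real (i + d)"
    using t(3) by (auto simp: zigzag_def)
  then have k: "i \<le> k" "k \<le> i + d" by linarith+
  show ?thesis
  proof (cases "d = 1")
    case True
    then show ?thesis using k by auto
  next
    case False
    then have "d = 2" using assms(2) by simp
    moreover from this have "odd k = odd i"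
      using t(4) by (simp add: zigzag_def of_bool_eq_iff)
    then have "k \<noteq> i + 1" by auto
    ultimately show ?thesis using k by auto
  qed
qed

text \<open>It suffices that \<open>w\<close> is an end of one segment, for then it is a vertex and
  the previous lemma applies to both segments.\<close>

lemma zigzag_segments_Int:
  assumes d: "d \<in> {1, 2}" "d' \<in> {1, 2}" and ne: "(i, d) \<noteq> (j, d')"
    and w: "w \<in> closed_segment (zigzag i) (zigzag (i + d))" "w \<in> closed_segment (zigzag j) (zigzag (j + d'))"
  shows "w \<in> zigzag ` ({i, i + d} \<inter> {j, j + d'})"
proof -
  obtain t where t: "0 \<le> t" "t \<le> 1" "Re w = real i + t * real d"
    "Im w = (if even d then of_bool (odd i) else if odd i then 1 - t else t)"
    and t': "t = 0 \<longrightarrow> w = zigzag i" "t = 1 \<longrightarrow> w = zigzag (i + d)"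
    by (rule zigzag_segment[OF w(1)])
  obtain s where s: "0 \<le> s" "s \<le> 1" "Re w = real j + s * real d'"
    "Im w = (if even d' then of_bool (odd j) else if odd j then 1 - s else s)"
    and s': "s = 0 \<longrightarrow> w = zigzag j" "s = 1 \<longrightarrow> w = zigzag (j + d')"
    by (rule zigzag_segment[OF w(2)])
  \<comment> \<open>If \<open>d\<close> and \<open>d'\<close> differ, one segment lies on a boundary
    line, which the other, crossing one meets only at an end. If they agree, the ranges of the real
    parts overlap in at most one point.\<close>
  have "t = 0 \<or> t = 1 \<or> s = 0 \<or> s = 1"
  proof (cases "d = d'")
    case False
    then show ?thesis
      using d t(4) s(4) by (auto simp: of_bool_def split: if_splits)
  next
    case True
    then have "i \<noteq> j" using ne by simp
    \<comment> \<open>For \<open>d = 2\<close> the common imaginary part forces \<open>i\<close> and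
      \<open>j\<close> to have equal parity, so distinct ones are at least 2 apart. As
      \<open>d\<close> is positive, a difference truncated to 0 cannot satisfy the
      inequality.\<close>
    have "d \<le> i - j \<or> d \<le> j - i"
    proof (cases "d = 1")
      case False
      then have "d = 2" using d by simp
      then have "odd i = odd j"
        using t(4) s(4) True by (simp add: of_bool_eq_iff)
      then have "i \<noteq> j + 1" "j \<noteq> i + 1" by auto
      then show ?thesis using \<open>i \<noteq> j\<close> \<open>d = 2\<close> by linarith
    qed (use \<open>i \<noteq> j\<close> in auto)
    then have "real i + d \<le> real j \<or> real j + d \<le> real i" using d by auto
    moreover have "real i + t * d = real j + s * d"
      using t s True by simp
    ultimately have "real d * (1 - t + s) \<le> 0 \<or> real d * (1 - s + t) \<le> 0"
      by (auto simp: algebra_simps)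
    then have "1 - t + s \<le> 0 \<or> 1 - s + t \<le> 0"
      using d by (auto simp: mult_le_0_iff)
    then show ?thesis using t s by linarith
  qed
  then obtain k where k: "w = zigzag k"
    using t' s' by blast
  then have "k \<in> {i, i + d} \<inter> {j, j + d'}"
    using zigzag_in_segment d w by blast
  then show ?thesis
    unfolding k by (rule imageI)
qed

lemma outerplanar_path_square: "outerplanar (path_square n)"
proof -
  \<comment> \<open>\<open>Min\<close> and \<open>Max\<close> fix a direction for each unordered
    edge.\<close>
  define c where "c e = linepath (zigzag (Min e)) (zigzag (Max e))" for e
  define D where "D = drawing (path_square n) zigzag c"
  have inj: "inj zigzag"
    by (auto simp: inj_def zigzag_def)
  have edgeE: P if e: "e \<in> edges (path_square n)" and P:
    "\<And>i d. d \<in> {1, 2} \<Longrightarrow> e = {i, i + d} \<Longrightarrow> c e = linepath (zigzag i) (zigzag (i + d)) \<Longrightarrow> P" for e P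
  proof -
    obtain i j where ij: "e = {i, j}" "i < j" "j \<le> i + 2"
      using e unfolding path_square_def snd_conv by blast
    then have "j - i \<in> {1, 2}" "j = i + (j - i)" by auto
    moreover from ij have "c e = linepath (zigzag i) (zigzag j)"
      by (simp add: c_def)
    ultimately show P using P ij(1) by metis
  qed
  have emb: "planar_embedding (path_square n) zigzag c"
    unfolding planar_embedding_def
  proof (intro conjI ballI impI)
    show "inj_on zigzag (verts (path_square n))"
      using inj by (rule inj_on_subset) simp
  next
    fix e assume e: "e \<in> edges (path_square n)"
    obtain i d where id: "d \<in> {1, 2}" "e = {i, i + d}" "c e = linepath (zigzag i) (zigzag (i + d))"
      by (rule edgeE[OF e])
    have "zigzag i \<noteq> zigzag (i + d)"
      using injD[OF inj, of i "i + d"] id(1) by auto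
    then show "arc (c e)"
      unfolding id(3) by (rule arc_linepath)
    show "{pathstart (c e), pathfinish (c e)} = zigzag ` e"
      unfolding id(3) unfolding id(2) by simp
    have "e \<subseteq> verts (path_square n)"
      using e simple_graph_path_square by (auto simp: simple_graph_def)
    then show "path_image (c e) \<inter> zigzag ` verts (path_square n) = zigzag ` e"
      using zigzag_in_segment[OF _ id(1)] unfolding id(3) unfolding id(2) by auto
  next
    fix e e' assume e: "e \<in> edges (path_square n)" "e' \<in> edges (path_square n)" "e \<noteq> e'"
    obtain i d where id: "d \<in> {1, 2}" "e = {i, i + d}" "c e = linepath (zigzag i) (zigzag (i + d))"
      by (rule edgeE[OF e(1)])
    obtain j d' where jd: "d' \<in> {1, 2}" "e' = {j, j + d'}" "c e' = linepath (zigzag j) (zigzag (j + d'))"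
      by (rule edgeE[OF e(2)])
    have "(i, d) \<noteq> (j, d')" using e(3) id jd by auto
    then show "path_image (c e) \<inter> path_image (c e') \<subseteq> zigzag ` (e \<inter> e')"
      using zigzag_segments_Int[OF id(1) jd(1)] unfolding id(3) jd(3) unfolding id(2) jd(2) by auto
  qed
  \<comment> \<open>The drawing lies in this convex strip, so the complement of the strip belongs to
    the outer face; all vertices lie on the boundary of the strip.\<close>
  define S where "S = {w. Im w \<ge> 0} \<inter> {w. Im w \<le> 1}"
  have S: "convex S"
    unfolding S_def by (intro convex_Int convex_halfspace_Im_ge convex_halfspace_Im_le)
  have zS: "zigzag k \<in> S" for k
    by (simp add: S_def zigzag_def)
  have "D \<subseteq> S"
  proof -
    have "path_image (c e) \<subseteq> S" for e
      unfolding c_def path_image_linepath using S zS by (intro closed_segment_subset)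
    then show ?thesis using zS by (auto simp: D_def drawing_def)
  qed
  then have out: "- S \<subseteq> outside D"
    using convex_in_outside[OF S] outside_mono by blast
  have "zigzag k \<in> frontier (outside D)" if "k \<in> verts (path_square n)" for k
  proof -
    have "zigzag k \<in> D"
      using that by (simp add: D_def drawing_def)
    then have "zigzag k \<notin> outside D"
      using outside_no_overlap[of D] by blast
    moreover have "zigzag k \<in> closure (- S)"
      unfolding closure_approachable
    proof (intro allI impI)
      fix \<epsilon> :: real assume "0 < \<epsilon>"
      \<comment> \<open>The point on the vertical line through the vertex, half of \<epsilon> above
        or below the strip.\<close>
      define y where "y = (if odd k then 1 + \<epsilon> / 2 else - \<epsilon> / 2)"
      have "Complex k y \<in> - S"
        using \<open>0 < \<epsilon>\<close> by (auto simp: S_def y_def)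
      moreover have "dist (Complex k y) (zigzag k) < \<epsilon>"
        using \<open>0 < \<epsilon>\<close> by (auto simp: y_def zigzag_def dist_norm cmod_def)
      ultimately show "\<exists>w\<in>- S. dist w (zigzag k) < \<epsilon>" by blast
    qed
    then have "zigzag k \<in> closure (outside D)"
      using closure_mono[OF out] by blast
    ultimately show ?thesis
      using interior_subset by (auto simp: frontier_def)
  qed
  then show ?thesis
    unfolding outerplanar_def using emb by (auto simp: D_def)
qed

theorem theorem4:
  fixes p q n :: nat
  assumes "2 \<le> p" and "p \<le> q" and "p + q + 2 \<le> n"
    and "3 \<le> p \<or> 4 \<le> q"
  shows "ex_OP n (double_star p q) = 2 * n - 3"
  unfolding ex_OP_def
proof (rule Max_eqI[OF finite_op_edge_counts])
  have n: "2 \<le> n" using assms by simp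
  show "m \<le> 2 * n - 3" if "m \<in> op_edge_counts n (double_star p q)" for m
    using that card_edges_outerplanar_le n unfolding op_edge_counts_def by blast
  have "card (verts (path_square n)) = n"
    by (simp add: path_square_def)
  then show "2 * n - 3 \<in> op_edge_counts n (double_star p q)"
    using simple_graph_path_square[of n] outerplanar_path_square[of n] card_edges_path_square[OF n]
      free_of_double_star_path_square[OF assms(2,4), of n]
    unfolding op_edge_counts_def by (metis (mono_tags, lifting) mem_Collect_eq)
qed

end
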